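(* Let $X_1,X_2$ be compact Hausdorff spaces, let $\mathcal{A}_1,\mathcal{A}_2$ be unital $C^*$-algebras, and let $J:C(X_1,\mathcal{A}_1)\to C(X_2,\mathcal{A}_2)$ be a Jordan $*$-isomorphism. Then there exist a continuous map $\varphi_\rho:X_2\to X_1$ for each $\rho\in \mathrm{PS}(\mathcal{A}_2)$ and a Jordan $*$-homomorphism $V_y:\mathcal{A}_1\to\mathcal{A}_2$ for each $y\in X_2$ such that $$\pi_\rho(JF(y))=\pi_\rho\big(V_y(F(\varphi_\rho(y)))\big)$$ for all $\rho\in\mathrm{PS}(\mathcal{A}_2)$, all $F\in C(X_1,\mathcal{A}_1)$ and all $y\in X_2$.
   Context: For a compact Hausdorff space $X$ and a unital $C^*$-algebra $\mathcal{A}$, $C(X,\mathcal{A})$ is the unital $C^*$-algebra of all continuous maps $F:X\to\mathcal{A}$ with pointwise operations and norm $\|F\|=\sup_{x\in X}\|F(x)\|_{\mathcal{A}}$. The Jordan product in a $*$-algebra is $a\circ b=\frac{ab+ba}{2}$. A Jordan $*$-homomorphism between $*$-algebras is a (complex) linear map $J$ with $J(a\circ b)=J(a)\circ J(b)$ for all $a,b$ and $J(a^* )=J(a)^*$ for all $a$. A Jordan $*$-isomorphism is a bijective Jordan $*$-homomorphism. A state (positive linear functional of norm $1$) $\rho$ on a $C^*$-algebra is pure if for every positive linear functional $\tau$ with $\tau\le\rho$ (i.e. $\rho-\tau$ positive) there is $t\in[0,1]$ with $\tau=t\rho$. $\mathrm{PS}(\mathcal{A})$ denotes the set of all pure states on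 $\mathcal{A}$. For a state $\rho$ on a unital $C^*$-algebra $\mathcal{A}$, $(\pi_\rho,H_\rho)$ denotes the cyclic (GNS) representation of $\mathcal{A}$ with a unit cyclic vector $x_\rho$ such that $\rho(a)=\langle\pi_\rho(a)x_\rho,x_\rho\rangle$ for all $a\in\mathcal{A}$. *)

theory Defs
  imports "HOL-Analysis.Analysis"
begin

section \<open>Complex vector spaces and Hilbert spaces\<close>

class scaleC =
  fixes scaleC :: "complex \<Rightarrow> 'a \<Rightarrow> 'a" (infixr \<open>*\<^sub>C\<close> 75)

class complex_vector = real_vector + scaleC +
  assumes scaleC_add_right: "c *\<^sub>C (x + y) = c *\<^sub>C x + c *\<^sub>C y"
    and scaleC_add_left: "(c + d) *\<^sub>C x = c *\<^sub>C x + d *\<^sub>C x"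
    and scaleC_scaleC: "c *\<^sub>C d *\<^sub>C x = (c * d) *\<^sub>C x"
    and scaleR_scaleC: "r *\<^sub>R x = complex_of_real r *\<^sub>C x"

global_interpretation complex_vector: vector_space "scaleC :: complex \<Rightarrow> 'a \<Rightarrow> 'a::complex_vector"
  by standard
    (simp_all add: scaleC_add_right scaleC_add_left scaleC_scaleC
      scaleR_scaleC[of 1, simplified, symmetric])

abbreviation clinear :: "('a::complex_vector \<Rightarrow> 'b::complex_vector) \<Rightarrow> bool"
  where "clinear \<equiv> Vector_Spaces.linear scaleC scaleC"

instantiation complex :: complex_vector
begin

definition scaleC_complex :: "complex \<Rightarrow> complex \<Rightarrow> complex"
  where [simp]: "scaleC_complex c z = c * z"

instance
  by standard (simp_all add: algebra_simps scaleR_conv_of_real)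

end

text \<open>The inner product is linear in the first argument.  The last axiom says that it is positive
  definite and induces the norm, which is complete by the class banach.\<close>

class complex_hilbert_space = complex_vector + banach +
  fixes cinner :: "'a \<Rightarrow> 'a \<Rightarrow> complex"
  assumes cinner_add_left: "cinner (x + y) z = cinner x z + cinner y z"
    and cinner_scaleC_left: "cinner (c *\<^sub>C x) y = c * cinner x y"
    and cinner_commute: "cinner y x = cnj (cinner x y)"
    and cinner_self: "cinner x x = complex_of_real ((norm x)\<^sup>2)"

instantiation complex :: complex_hilbert_space
begin

definition cinner_complex :: "complex \<Rightarrow> complex \<Rightarrow> complex"
  where "cinner_complex x y = x * cnj y"

instance
  by standard
    (simp_all add: cinner_complex_def algebra_simps complex_norm_square del: of_real_power)

end


section \<open>Unital C*-algebras\<close>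

class star_algebra = complex_vector + ring +
  fixes star :: "'a \<Rightarrow> 'a" (\<open>_\<^sup>\<star>\<close> [1000] 999)
  assumes mult_scaleC_left: "(c *\<^sub>C a) * b = c *\<^sub>C (a * b)"
    and mult_scaleC_right: "a * (c *\<^sub>C b) = c *\<^sub>C (a * b)"
    and star_add: "(a + b)\<^sup>\<star> = a\<^sup>\<star> + b\<^sup>\<star>"
    and star_scaleC: "(c *\<^sub>C a)\<^sup>\<star> = cnj c *\<^sub>C a\<^sup>\<star>"
    and star_mult: "(a * b)\<^sup>\<star> = b\<^sup>\<star> * a\<^sup>\<star>"
    and star_star: "(a\<^sup>\<star>)\<^sup>\<star> = a"

class unital_cstar_algebra = star_algebra + real_normed_algebra_1 + banach +
  assumes norm_scaleC: "norm (c *\<^sub>C a) = cmod c * norm a"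
    and cstar_identity: "norm (a\<^sup>\<star> * a) = (norm a)\<^sup>2"

instantiation complex :: unital_cstar_algebra
begin

definition star_complex :: "complex \<Rightarrow> complex"
  where "star_complex = cnj"

instance
  by standard (simp_all add: star_complex_def norm_mult power2_eq_square)

end

lemma norm_star_le:
  fixes a :: "'a::unital_cstar_algebra"
  shows "norm (a\<^sup>\<star>) \<le> norm a"
proof (cases "a\<^sup>\<star> = 0")
  case False
  have "norm (a\<^sup>\<star>) * norm (a\<^sup>\<star>) = norm (a * a\<^sup>\<star>)"
    using cstar_identity[of "a\<^sup>\<star>"] by (simp add: star_star power2_eq_square)
  also have "\<dots> \<le> norm a * norm (a\<^sup>\<star>)"
    by (rule norm_mult_ineq)
  finally show ?thesis
    using False by simp
qed simp

lemma norm_star: "norm (a\<^sup>\<star>) = norm a" for a :: "'a::unital_cstar_algebra"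
  using norm_star_le[of a] norm_star_le[of "a\<^sup>\<star>"] by (simp add: star_star)

lemma bounded_linear_star: "bounded_linear (star :: 'a \<Rightarrow> 'a::unital_cstar_algebra)"
  by (rule bounded_linear_intro[where K = 1])
    (simp_all add: star_add scaleR_scaleC star_scaleC norm_star)

lemma bounded_linear_scaleC: "bounded_linear (\<lambda>a::'a::unital_cstar_algebra. c *\<^sub>C a)"
  by (rule bounded_linear_intro[where K = "cmod c"])
    (simp_all add: scaleC_add_right scaleR_scaleC scaleC_scaleC norm_scaleC mult.commute)


section \<open>The C*-algebra of continuous maps\<close>

text \<open>If \<open>'x\<close> is compact, every continuous map on it is bounded, so the library type \<open>'x \<Rightarrow>\<^sub>C 'a\<close>
  of bounded continuous maps with the supremum norm is C(X, A).  It is made a unital C*-algebra by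
  the pointwise operations.  The library proves its completeness only for metric domains.\<close>

instance bcontfun :: (topological_space, complete_space) complete_space
proof
  fix f :: "nat \<Rightarrow> ('a, 'b) bcontfun"
  assume "Cauchy f"
  then obtain g where "uniform_limit UNIV f g sequentially"
    using uniformly_convergent_eq_cauchy[of "\<lambda>_. True" f]
    unfolding Cauchy_def uniform_limit_sequentially_iff
    by (metis dist_fun_lt_imp_dist_val_lt)
  from uniform_limit_bcontfunE[OF this sequentially_bot]
  obtain l' where "g = apply_bcontfun l'" "f \<longlonglongrightarrow> l'"
    by metis
  then show "convergent f"
    by (intro convergentI)
qed

instance bcontfun :: (topological_space, banach) banach ..

lemma bcontfun_compose_bounded_linear:
  assumes "bounded_linear h" "f \<in> bcontfun"
  shows "(\<lambda>x. h (f x)) \<in> bcontfun"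
  using assms bounded_linear_image[of "range f" h]
  by (auto simp: bcontfun_def image_image intro: bounded_linear.continuous_on)

lemma bcontfun_mult:
  fixes f g :: "'x::topological_space \<Rightarrow> 'a::real_normed_algebra"
  assumes "f \<in> bcontfun" "g \<in> bcontfun"
  shows "(\<lambda>x. f x * g x) \<in> bcontfun"
proof -
  from assms obtain K L where "\<And>x. norm (f x) \<le> K" "\<And>x. norm (g x) \<le> L"
    by (auto simp: bcontfun_def bounded_iff)
  then have "norm (f x * g x) \<le> K * L" for x
    by (meson mult_mono norm_ge_zero norm_mult_ineq order_trans)
  then show ?thesis
    using assms by (intro bcontfun_normI) (auto simp: bcontfun_def intro!: continuous_intros)
qed

unbundle bcontfun.lifting

instantiation bcontfun :: (topological_space, unital_cstar_algebra) unital_cstar_algebra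
begin

lift_definition one_bcontfun :: "'a \<Rightarrow>\<^sub>C 'b" is "\<lambda>_. 1"
  by (rule const_bcontfun)

lift_definition times_bcontfun :: "('a \<Rightarrow>\<^sub>C 'b) \<Rightarrow> ('a \<Rightarrow>\<^sub>C 'b) \<Rightarrow> 'a \<Rightarrow>\<^sub>C 'b"
  is "\<lambda>f g x. f x * g x"
  by (rule bcontfun_mult)

lift_definition scaleC_bcontfun :: "complex \<Rightarrow> ('a \<Rightarrow>\<^sub>C 'b) \<Rightarrow> 'a \<Rightarrow>\<^sub>C 'b"
  is "\<lambda>c f x. c *\<^sub>C f x"
  by (rule bcontfun_compose_bounded_linear[OF bounded_linear_scaleC])

lift_definition star_bcontfun :: "('a \<Rightarrow>\<^sub>C 'b) \<Rightarrow> 'a \<Rightarrow>\<^sub>C 'b"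
  is "\<lambda>f x. (f x)\<^sup>\<star>"
  by (rule bcontfun_compose_bounded_linear[OF bounded_linear_star])

lemmas [simp] =
  one_bcontfun.rep_eq
  times_bcontfun.rep_eq
  scaleC_bcontfun.rep_eq
  star_bcontfun.rep_eq

instance
proof
  fix f g h :: "'a \<Rightarrow>\<^sub>C 'b" and c d :: complex and r :: real
  show "c *\<^sub>C (f + g) = c *\<^sub>C f + c *\<^sub>C g"
    by (rule bcontfun_eqI) (simp add: scaleC_add_right)
  show "(c + d) *\<^sub>C f = c *\<^sub>C f + d *\<^sub>C f"
    by (rule bcontfun_eqI) (simp add: scaleC_add_left)
  show "c *\<^sub>C d *\<^sub>C f = (c * d) *\<^sub>C f"
    by (rule bcontfun_eqI) (simp add: scaleC_scaleC)
  show "r *\<^sub>R f = complex_of_real r *\<^sub>C f"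
    by (rule bcontfun_eqI) (simp add: scaleR_scaleC)
  show "f * g * h = f * (g * h)" "(f + g) * h = f * h + g * h" "f * (g + h) = f * g + f * h"
    "1 * f = f" "f * 1 = f" "(r *\<^sub>R f) * g = r *\<^sub>R (f * g)" "f * (r *\<^sub>R g) = r *\<^sub>R (f * g)"
    by (rule bcontfun_eqI; simp add: algebra_simps)+
  show "(c *\<^sub>C f) * g = c *\<^sub>C (f * g)"
    by (rule bcontfun_eqI) (simp add: mult_scaleC_left)
  show "f * (c *\<^sub>C g) = c *\<^sub>C (f * g)"
    by (rule bcontfun_eqI) (simp add: mult_scaleC_right)
  show "(f + g)\<^sup>\<star> = f\<^sup>\<star> + g\<^sup>\<star>"
    by (rule bcontfun_eqI) (simp add: star_add)
  show "(c *\<^sub>C f)\<^sup>\<star> = cnj c *\<^sub>C f\<^sup>\<star>"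
    by (rule bcontfun_eqI) (simp add: star_scaleC)
  show "(f * g)\<^sup>\<star> = g\<^sup>\<star> * f\<^sup>\<star>"
    by (rule bcontfun_eqI) (simp add: star_mult)
  show "(f\<^sup>\<star>)\<^sup>\<star> = f"
    by (rule bcontfun_eqI) (simp add: star_star)
  show "(0::'a \<Rightarrow>\<^sub>C 'b) \<noteq> 1"
    by (metis one_bcontfun.rep_eq zero_bcontfun.rep_eq zero_neq_one)
  show norm_mult: "norm (f * g) \<le> norm f * norm g" for f g :: "'a \<Rightarrow>\<^sub>C 'b"
  proof (rule norm_bound)
    fix x
    have "norm (f x * g x) \<le> norm (f x) * norm (g x)"
      by (rule norm_mult_ineq)
    also have "\<dots> \<le> norm f * norm g"
      by (intro mult_mono norm_bounded) simp_all
    finally show "norm ((f * g) x) \<le> norm f * norm g"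
      by simp
  qed
  show "norm (1::'a \<Rightarrow>\<^sub>C 'b) = 1"
    using norm_bounded[of "1::'a \<Rightarrow>\<^sub>C 'b" undefined]
    by (intro antisym norm_bound) simp_all
  have scaleC_le: "norm (c *\<^sub>C f) \<le> cmod c * norm f" for c and f :: "'a \<Rightarrow>\<^sub>C 'b"
    by (rule norm_bound) (simp add: norm_scaleC mult_left_mono norm_bounded)
  have scaleC_inverse: "inverse c *\<^sub>C c *\<^sub>C f = f" if "c \<noteq> 0"
    by (rule bcontfun_eqI) (use that in \<open>simp add: scaleC_scaleC\<close>)
  show "norm (c *\<^sub>C f) = cmod c * norm f"
  proof (cases "c = 0")
    case True
    have "0 *\<^sub>C f = 0"
      by (rule bcontfun_eqI) simp
    then show ?thesis
      using True by simp
  next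
    case False
    have "norm f \<le> inverse (cmod c) * norm (c *\<^sub>C f)"
      using scaleC_le[of "inverse c" "c *\<^sub>C f"] scaleC_inverse[OF False]
      by (simp add: norm_inverse)
    then have "cmod c * norm f \<le> norm (c *\<^sub>C f)"
      using False by (simp add: field_simps)
    with scaleC_le[of c f] show ?thesis
      by simp
  qed
  show "norm (f\<^sup>\<star> * f) = (norm f)\<^sup>2"
  proof (rule antisym)
    have "norm (f\<^sup>\<star>) \<le> norm f"
      by (rule norm_bound) (simp add: norm_star norm_bounded)
    then show "norm (f\<^sup>\<star> * f) \<le> (norm f)\<^sup>2"
      using norm_mult[of "f\<^sup>\<star>" f]
      by (metis mult_right_mono norm_ge_zero order_trans power2_eq_square)
    have "norm f \<le> sqrt (norm (f\<^sup>\<star> * f))"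
    proof (rule norm_bound)
      fix x
      have "(norm (f x))\<^sup>2 \<le> norm (f\<^sup>\<star> * f)"
        using norm_bounded[of "f\<^sup>\<star> * f" x] by (simp add: cstar_identity)
      then show "norm (f x) \<le> sqrt (norm (f\<^sup>\<star> * f))"
        by (rule real_le_rsqrt)
    qed
    then show "(norm f)\<^sup>2 \<le> norm (f\<^sup>\<star> * f)"
      by (metis norm_ge_zero power_mono real_sqrt_pow2)
  qed
qed

end

lifting_update bcontfun.lifting
lifting_forget bcontfun.lifting


section \<open>Jordan *-homomorphisms\<close>

definition jordan_prod :: "'a::star_algebra \<Rightarrow> 'a \<Rightarrow> 'a"
  where "jordan_prod a b = (1/2) *\<^sub>C (a * b + b * a)"

definition jordan_star_hom :: "('a::star_algebra \<Rightarrow> 'b::star_algebra) \<Rightarrow> bool"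
  where "jordan_star_hom J \<longleftrightarrow> clinear J
    \<and> (\<forall>a b. J (jordan_prod a b) = jordan_prod (J a) (J b))
    \<and> (\<forall>a. J (a\<^sup>\<star>) = (J a)\<^sup>\<star>)"

definition jordan_star_iso :: "('a::star_algebra \<Rightarrow> 'b::star_algebra) \<Rightarrow> bool"
  where "jordan_star_iso J \<longleftrightarrow> jordan_star_hom J \<and> bij J"


section \<open>Pure states\<close>

text \<open>The positive elements of a C*-algebra are those of the form \<open>a\<^sup>\<star> * a\<close>.\<close>

definition positive_functional :: "('a::unital_cstar_algebra \<Rightarrow> complex) \<Rightarrow> bool"
  where "positive_functional \<tau> \<longleftrightarrow> clinear \<tau> \<and> (\<forall>a. \<tau> (a\<^sup>\<star> * a) \<in> \<real>\<^sub>\<ge>\<^sub>0)"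

text \<open>Boundedness is stated because \<open>onorm\<close> is only meaningful for bounded maps.\<close>

definition state :: "('a::unital_cstar_algebra \<Rightarrow> complex) \<Rightarrow> bool"
  where "state \<rho> \<longleftrightarrow> positive_functional \<rho> \<and> bounded_linear \<rho> \<and> onorm \<rho> = 1"

definition pure_states :: "('a::unital_cstar_algebra \<Rightarrow> complex) set"
  where "pure_states = {\<rho>. state \<rho> \<and>
    (\<forall>\<tau>. positive_functional \<tau> \<and> positive_functional (\<lambda>a. \<rho> a - \<tau> a) \<longrightarrow>
      (\<exists>t\<in>{0..1}. \<forall>a. \<tau> a = complex_of_real t * \<rho> a))}"


section \<open>Cyclic representations\<close>

text \<open>The GNS spaces of different states may have different dimensions, so a representation acts on
  a closed subspace \<open>H\<close> of an ambient Hilbert space \<open>'h\<close>; the values of the operators outside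
  \<open>H\<close> are irrelevant.  Every Hilbert space, and every family of Hilbert spaces simultaneously,
  embeds isometrically as closed subspaces of a large enough \<open>'h\<close>.\<close>

definition bounded_operator_on :: "'h::complex_hilbert_space set \<Rightarrow> ('h \<Rightarrow> 'h) \<Rightarrow> bool"
  where "bounded_operator_on H T \<longleftrightarrow> T ` H \<subseteq> H
    \<and> (\<forall>u\<in>H. \<forall>v\<in>H. T (u + v) = T u + T v)
    \<and> (\<forall>c. \<forall>u\<in>H. T (c *\<^sub>C u) = c *\<^sub>C T u)
    \<and> (\<exists>K. \<forall>u\<in>H. norm (T u) \<le> K * norm u)"

definition representation ::
    "'h::complex_hilbert_space set \<Rightarrow> ('a::unital_cstar_algebra \<Rightarrow> 'h \<Rightarrow> 'h) \<Rightarrow> bool"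
  where "representation H \<pi> \<longleftrightarrow> complex_vector.subspace H \<and> closed H
    \<and> (\<forall>a. bounded_operator_on H (\<pi> a))
    \<and> (\<forall>a b. \<forall>u\<in>H. \<pi> (a + b) u = \<pi> a u + \<pi> b u)
    \<and> (\<forall>c a. \<forall>u\<in>H. \<pi> (c *\<^sub>C a) u = c *\<^sub>C \<pi> a u)
    \<and> (\<forall>a b. \<forall>u\<in>H. \<pi> (a * b) u = \<pi> a (\<pi> b u))
    \<and> (\<forall>a. \<forall>u\<in>H. \<forall>v\<in>H. cinner (\<pi> (a\<^sup>\<star>) u) v = cinner u (\<pi> a v))"

definition gns_representation ::
    "('a::unital_cstar_algebra \<Rightarrow> complex) \<Rightarrow> 'h::complex_hilbert_space set
      \<Rightarrow> ('a \<Rightarrow> 'h \<Rightarrow> 'h) \<Rightarrow> 'h \<Rightarrow> bool"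
  where "gns_representation \<rho> H \<pi> \<xi> \<longleftrightarrow> representation H \<pi>
    \<and> \<xi> \<in> H \<and> norm \<xi> = 1
    \<and> closure (range (\<lambda>a. \<pi> a \<xi>)) = H
    \<and> (\<forall>a. \<rho> a = cinner (\<pi> a \<xi>) \<xi>)"

end

theory Submission
  imports Defs
begin

text \<open>\<open>V\<^sub>y\<close> is the composition of the embedding of \<open>A\<^sub>1\<close> as constant maps, \<open>J\<close>, and the evaluation
  at \<open>y\<close>.  A Jordan isomorphism maps the centre into the centre and is multiplicative against
  central factors, so for a real function \<open>f\<close> on \<open>X\<^sub>1\<close> the element \<open>w\<^sub>f = J(f 1)(y)\<close> is central.
  If \<open>0 \<le> f \<le> 1\<close> then \<open>w\<^sub>f\<close> and \<open>1 - w\<^sub>f\<close> are squares of self-adjoint central elements, so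
  \<open>a \<mapsto> \<rho>(w\<^sub>f a)\<close> is a positive functional below \<open>\<rho>\<close>; by purity \<open>\<rho>(w\<^sub>f a) = \<eta>(f) \<rho>(a)\<close>, and \<open>\<eta>\<close> is
  the evaluation at a point \<open>\<phi>\<^sub>\<rho>(y)\<close>.  Finally, a map \<open>F\<close> vanishing at \<open>\<phi>\<^sub>\<rho>(y)\<close> is the product of the
  scalar function \<open>\<parallel>F\<parallel>\<^sup>1\<^sup>/\<^sup>2\<close>, which also vanishes there, and a continuous map, so \<open>\<pi>\<^sub>\<rho>(JF(y)) = 0\<close>.  This
  factorization makes the continuity of \<open>J\<close> unnecessary.\<close>

section \<open>Central elements and Jordan isomorphisms\<close>

lemma clinear_iff:
  "clinear f \<longleftrightarrow> (\<forall>x y. f (x + y) = f x + f y) \<and> (\<forall>c x. f (c *\<^sub>C x) = c *\<^sub>C f x)"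
  by (simp add: Vector_Spaces.linear_iff complex_vector.vector_space_axioms)

lemma clinear_zero: "clinear f \<Longrightarrow> f 0 = 0"
  by (metis add_cancel_right_right clinear_iff)

lemma clinear_diff: "clinear f \<Longrightarrow> f (x - y) = f x - f y"
  by (metis add_diff_cancel_right' clinear_iff diff_add_cancel)

lemma clinear_scaleR: "clinear f \<Longrightarrow> f (r *\<^sub>R x) = r *\<^sub>R f x"
  by (simp add: clinear_iff scaleR_scaleC)

lemma star_one: "(1::'a::unital_cstar_algebra)\<^sup>\<star> = 1"
  by (metis mult.left_neutral mult.right_neutral star_mult star_star)

definition central :: "'a::ring \<Rightarrow> bool"
  where "central z \<longleftrightarrow> (\<forall>a. z * a = a * z)"

lemma central_commute: "central z \<Longrightarrow> a * z = z * a"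
  by (simp add: central_def)

text \<open>Moving \<open>d\<close> past its adjoint brings the two factors \<open>d\<close>
  together, so the C*-identity for \<open>d\<^sup>\<star> * d\<close> and then for \<open>d\<close>
  forces \<open>d = 0\<close>.\<close>

lemma central_nilpotent:
  fixes d :: "'a::unital_cstar_algebra"
  assumes "central d" and "d * d = 0"
  shows "d = 0"
proof -
  have "(d\<^sup>\<star> * d)\<^sup>\<star> * (d\<^sup>\<star> * d) = d\<^sup>\<star> * d\<^sup>\<star> * (d * d)"
    using assms(1) by (metis (no_types) central_def mult.assoc star_mult star_star)
  then have "norm (d\<^sup>\<star> * d) = 0"
    using cstar_identity[of "d\<^sup>\<star> * d"] assms(2) by simp
  then show ?thesis
    using cstar_identity[of d] by simp
qed

text \<open>A Kleinecke--Shirokov argument: \<open>d = [w, b]\<close> and \<open>[w, b w] = d w\<close> are central, hence \<open>d\<^sup>2 = 0\<close>.\<close>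

lemma central_if_commutators_central:
  fixes w :: "'a::unital_cstar_algebra"
  assumes "\<And>b. central (w * b - b * w)"
  shows "central w"
  unfolding central_def
proof
  fix b
  define d where "d = w * b - b * w"
  have d: "central d" and dw: "central (d * w)"
    using assms[of b] assms[of "b * w"] by (simp_all add: d_def algebra_simps)
  have "d * d = d * w * b - d * (b * w)"
    by (simp add: d_def algebra_simps)
  also have "d * (b * w) = b * (d * w)"
    using central_commute[OF d, of b] by (metis mult.assoc)
  also have "d * w * b - b * (d * w) = 0"
    using central_commute[OF dw, of b] by simp
  finally show "w * b = b * w"
    using central_nilpotent[OF d] by (simp add: d_def)
qed

lemma jordan_star_homD:
  assumes "jordan_star_hom J"
  shows "clinear J" and "J (a\<^sup>\<star>) = (J a)\<^sup>\<star>"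
    and "J (a * b + b * a) = J a * J b + J b * J a"
proof -
  show lin: "clinear J" and "J (a\<^sup>\<star>) = (J a)\<^sup>\<star>"
    using assms by (simp_all add: jordan_star_hom_def)
  have two: "x = 2 *\<^sub>C (1/2) *\<^sub>C x" for x :: "'c::complex_vector"
    by (simp add: scaleC_scaleC)
  have "J (a * b + b * a) = 2 *\<^sub>C J (jordan_prod a b)"
    using lin unfolding clinear_iff jordan_prod_def by (metis two)
  also have "J (jordan_prod a b) = jordan_prod (J a) (J b)"
    using assms by (simp add: jordan_star_hom_def)
  finally show "J (a * b + b * a) = J a * J b + J b * J a"
    by (simp add: jordan_prod_def flip: two)
qed

lemma half_double: "a + a = b + b \<Longrightarrow> a = b" for a b :: "'a::real_vector"
  by (metis scaleR_2 scaleR_cancel_left zero_neq_numeral)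

context
  fixes J :: "'a::unital_cstar_algebra \<Rightarrow> 'b::unital_cstar_algebra"
  assumes iso: "jordan_star_iso J"
begin

lemma jordan_iso_hom: "jordan_star_hom J"
  using iso by (simp add: jordan_star_iso_def)

lemma jordan_iso_surj: "surj J"
  using iso by (simp add: jordan_star_iso_def bij_is_surj)

text \<open>Doubling commutes with \<open>J\<close>, and for a preimage \<open>e\<close> of 1 the
  Jordan product of \<open>1\<close> and \<open>e\<close> is \<open>e\<close>; compare both
  sides.\<close>

lemma jordan_iso_one: "J 1 = 1"
proof -
  obtain e where e: "J e = 1"
    by (metis jordan_iso_surj surjD)
  have "J e + J e = J 1 + J 1"
    using jordan_star_homD(3)[OF jordan_iso_hom, of 1 e] jordan_star_homD(1)[OF jordan_iso_hom]
    by (simp add: e clinear_iff)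
  then show ?thesis
    using half_double e by metis
qed

text \<open>\<open>J\<close> need not preserve single commutators, only double ones. These vanish
  when one starts from a central \<open>z\<close>, so by surjectivity all commutators of
  \<open>J z\<close> are central.\<close>

lemma jordan_iso_central:
  assumes "central z"
  shows "central (J z)"
proof (rule central_if_commutators_central)
  note hom = jordan_star_homD[OF jordan_iso_hom]
  text \<open>Double commutators are Jordan polynomials, so \<open>J\<close> preserves them.\<close>
  have comm: "(a * b - b * a) * c - c * (a * b - b * a)
      = (a * (b * c + c * b) + (b * c + c * b) * a) - (b * (a * c + c * a) + (a * c + c * a) * b)"
    for a b c :: "'r::ring"
    by (simp add: algebra_simps)
  have J_comm: "J ((a * b - b * a) * c - c * (a * b - b * a))
      = (J a * J b - J b * J a) * J c - J c * (J a * J b - J b * J a)" for a b c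
    unfolding comm by (simp only: clinear_diff[OF hom(1)] hom(3))
  fix b
  show "central (J z * b - b * J z)"
    unfolding central_def
  proof
    fix c
    obtain b' c' where "b = J b'" "c = J c'"
      using jordan_iso_surj by (metis surjD)
    moreover have "z * b' - b' * z = 0"
      using assms by (simp add: central_def)
    ultimately show "(J z * b - b * J z) * c = c * (J z * b - b * J z)"
      using J_comm[of z b' c'] by (simp add: clinear_zero[OF hom(1)])
  qed
qed

text \<open>With a central factor the Jordan product is the ordinary product, and \<open>J z\<close>
  is again central.\<close>

lemma jordan_iso_mult_central:
  assumes "central z"
  shows "J (z * a) = J z * J a"
proof (rule half_double)
  note hom = jordan_star_homD[OF jordan_iso_hom]
  have "J (z * a) + J (z * a) = J (z * a + a * z)"
    using hom(1) by (simp add: clinear_iff central_commute[OF assms])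
  also have "\<dots> = J z * J a + J z * J a"
    by (simp add: hom(3) central_commute[OF jordan_iso_central[OF assms]])
  finally show "J (z * a) + J (z * a) = J z * J a + J z * J a" .
qed

end


section \<open>Real functions on a compact space\<close>

text \<open>If each point \<open>x\<close> had a function \<open>f x\<close> refuting it, the square
  of \<open>f x - \<eta> (f x)\<close> would be killed by \<eta> and positive at \<open>x\<close>.
  By compactness a finite sum of such squares is positive everywhere, hence invertible, although
  \<eta> kills it.\<close>

lemma character_is_evaluation:
  fixes \<eta> :: "('x::topological_space \<Rightarrow> real) \<Rightarrow> real"
  assumes "compact (UNIV :: 'x set)"
    and add: "\<And>f g. continuous_on UNIV f \<Longrightarrow> continuous_on UNIV g \<Longrightarrow> \<eta> (\<lambda>x. f x + g x) = \<eta> f + \<eta> g"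
    and mult: "\<And>f g. continuous_on UNIV f \<Longrightarrow> continuous_on UNIV g \<Longrightarrow> \<eta> (\<lambda>x. f x * g x) = \<eta> f * \<eta> g"
    and const: "\<And>c. \<eta> (\<lambda>_. c) = c"
  shows "\<exists>x. \<forall>f. continuous_on UNIV f \<longrightarrow> \<eta> f = f x"
proof (rule ccontr)
  assume "\<not> ?thesis"
  then obtain f where f: "\<And>x. continuous_on UNIV (f x)" "\<And>x. \<eta> (f x) \<noteq> f x x"
    by metis
  \<comment> \<open>The form \<open>+ -\<close> lets \<open>add\<close> and \<open>const\<close>
    apply to the shifted function.\<close>
  define g where "g = (\<lambda>x u. (f x u + - \<eta> (f x)) * (f x u + - \<eta> (f x)))"
  have g_cont: "continuous_on UNIV (g x)" for x
    unfolding g_def by (intro continuous_intros f(1))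
  have g_zero: "\<eta> (g x) = 0" for x
    unfolding g_def by (simp add: mult add const f(1) continuous_intros del: add_uminus_conv_diff)
  have g_nonneg: "g x u \<ge> 0" for x u
    unfolding g_def by (rule zero_le_square)
  have g_pos: "g x x > 0" for x
  proof -
    have "f x x + - \<eta> (f x) \<noteq> 0"
      using f(2)[of x] by simp
    then show ?thesis
      unfolding g_def using not_real_square_gt_zero by blast
  qed
  obtain D where D: "finite D" "UNIV \<subseteq> (\<Union>x\<in>D. {u. 0 < g x u})"
  proof (rule compactE_image[OF assms(1), of UNIV "\<lambda>x. {u. 0 < g x u}"])
    show "open {u. 0 < g x u}" for x
      by (intro open_Collect_less continuous_on_const g_cont)
    show "UNIV \<subseteq> (\<Union>x. {u. 0 < g x u})"
      using g_pos by auto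
  qed
  define s where "s = (\<lambda>u. \<Sum>x\<in>D. g x u)"
  have s_pos: "s u > 0" for u
  proof -
    obtain x where "x \<in> D" "g x u > 0"
      using D(2) by auto
    then show ?thesis
      using D(1) g_nonneg unfolding s_def by (intro sum_pos2)
  qed
  have s_cont: "continuous_on UNIV s"
    unfolding s_def by (intro continuous_intros g_cont)
  have "\<eta> (\<lambda>u. \<Sum>x\<in>D. g x u) = (\<Sum>x\<in>D. \<eta> (g x))"
    using D(1) by induction (simp_all add: const add g_cont continuous_on_sum)
  then have "\<eta> s = 0"
    by (simp add: s_def g_zero)
  moreover have "continuous_on UNIV (\<lambda>u. inverse (s u))"
    using s_pos by (intro continuous_intros s_cont) (simp add: less_imp_neq[symmetric])
  then have "\<eta> (\<lambda>u. s u * inverse (s u)) = \<eta> s * \<eta> (\<lambda>u. inverse (s u))"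
    by (intro mult s_cont)
  moreover have "(\<lambda>u. s u * inverse (s u)) = (\<lambda>_. 1)"
    using s_pos by (simp add: fun_eq_iff less_imp_neq[symmetric])
  ultimately show False
    using const[of 1] by simp
qed

text \<open>A compact Hausdorff space is normal, so Urysohn functions separate points from closed
  sets and real functions determine the topology.\<close>

lemma continuous_into_compact_Hausdorff:
  fixes \<phi> :: "'y::topological_space \<Rightarrow> 'x::t2_space"
  assumes "compact (UNIV :: 'x set)"
    and cont: "\<And>f :: 'x \<Rightarrow> real. continuous_on UNIV f \<Longrightarrow> continuous_on UNIV (\<lambda>y. f (\<phi> y))"
  shows "continuous_on UNIV \<phi>"
  unfolding continuous_on_def
proof (intro ballI topological_tendstoI)
  fix y U
  assume U: "open U" "\<phi> y \<in> U"
  have "Hausdorff_space (euclidean :: 'x topology)"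
    unfolding Hausdorff_space_def disjnt_def using hausdorff by (simp, meson)
  then have "normal_space (euclidean :: 'x topology)"
    using assms(1) by (simp add: compact_Hausdorff_or_regular_imp_normal_space compact_space_def)
  moreover have "closedin euclidean {\<phi> y}" "closedin euclidean (- U)" "disjnt {\<phi> y} (- U)"
    using U by (simp_all add: disjnt_def closed_Compl)
  ultimately obtain f :: "'x \<Rightarrow> real" where "continuous_map euclidean euclideanreal f"
      "f ` {\<phi> y} \<subseteq> {0}" "f ` (- U) \<subseteq> {1}"
    by (rule Urysohn_lemma_alt)
  then have f: "continuous_on UNIV f" "f (\<phi> y) = 0" "\<And>x. x \<notin> U \<Longrightarrow> f x = 1"
    by auto
  have "open {v. f (\<phi> v) < 1}"
    by (intro open_Collect_less continuous_on_const cont f(1))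
  then have "\<forall>\<^sub>F v in at y. f (\<phi> v) < 1"
    using f(2) unfolding eventually_at_topological by (intro exI[of _ "{v. f (\<phi> v) < 1}"]) simp
  then show "\<forall>\<^sub>F v in at y. \<phi> v \<in> U"
    by eventually_elim (metis f(3) less_irrefl)
qed

section \<open>Real functions as central elements of the algebra of continuous maps\<close>

definition scalar_fun :: "('x::topological_space \<Rightarrow> real) \<Rightarrow> 'x \<Rightarrow>\<^sub>C 'a::unital_cstar_algebra"
  where "scalar_fun f = Bcontfun (\<lambda>x. f x *\<^sub>R 1)"

context
  assumes compact: "compact (UNIV :: 'x::topological_space set)"
begin

lemma continuous_imp_bcontfun:
  fixes f :: "'x \<Rightarrow> 'c::metric_space"
  assumes "continuous_on UNIV f"
  shows "f \<in> bcontfun"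
  using assms compact_continuous_image[OF assms compact] by (simp add: bcontfun_def compact_imp_bounded)

text \<open>Compactness makes a continuous \<open>f\<close> bounded, which is what gives
  \<open>Bcontfun\<close> its intended value.\<close>

lemma scalar_fun_apply [simp]:
  fixes f :: "'x \<Rightarrow> real"
  assumes "continuous_on UNIV f"
  shows "scalar_fun f x = f x *\<^sub>R 1"
  unfolding scalar_fun_def using assms
  by (subst Bcontfun_inverse) (auto intro!: continuous_imp_bcontfun continuous_intros)

lemma scalar_fun_central:
  fixes f :: "'x \<Rightarrow> real"
  assumes "continuous_on UNIV f"
  shows "central (scalar_fun f)"
  unfolding central_def by (intro allI bcontfun_eqI) (simp add: assms)

lemma scalar_fun_add:
  fixes f g :: "'x \<Rightarrow> real"
  assumes "continuous_on UNIV f" "continuous_on UNIV g"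
  shows "scalar_fun (\<lambda>x. f x + g x) = scalar_fun f + scalar_fun g"
  by (rule bcontfun_eqI) (simp add: assms continuous_on_add scaleR_add_left)

lemma scalar_fun_mult:
  fixes f g :: "'x \<Rightarrow> real"
  assumes "continuous_on UNIV f" "continuous_on UNIV g"
  shows "scalar_fun (\<lambda>x. f x * g x) = scalar_fun f * scalar_fun g"
  by (rule bcontfun_eqI) (simp add: assms continuous_on_mult)

lemma scalar_fun_const: "scalar_fun (\<lambda>_::'x. c) = c *\<^sub>R 1"
  by (rule bcontfun_eqI) simp

lemma scalar_fun_star:
  fixes f :: "'x \<Rightarrow> real"
  assumes "continuous_on UNIV f"
  shows "(scalar_fun f)\<^sup>\<star> = scalar_fun f"
  by (rule bcontfun_eqI) (simp add: assms scaleR_scaleC star_scaleC star_one)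

lemma scalar_fun_factorization:
  fixes F :: "'x \<Rightarrow>\<^sub>C 'a::unital_cstar_algebra"
  obtains g G where "continuous_on UNIV g" "F = scalar_fun g * G" "\<And>x. F x = 0 \<Longrightarrow> g x = 0"
proof
  \<comment> \<open>The second factor is \<open>h\<close> composed with \<open>F\<close>. The
    critical point for continuity is 0, where \<open>norm (h v) = sqrt (norm v)\<close> tends to
    0.\<close>
  define h where "h v = inverse (sqrt (norm v)) *\<^sub>R v" for v :: 'a
  have h_norm: "norm (h v) = sqrt (norm v)" for v
    by (cases "v = 0") (simp_all add: h_def field_simps)
  have "isCont h v" for v
  proof (cases "v = 0")
    case True
    have "((\<lambda>v::'a. sqrt (norm v)) \<longlongrightarrow> sqrt (norm (0::'a))) (at 0)"
      by (intro tendsto_intros)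
    then have "((\<lambda>v. norm (h v)) \<longlongrightarrow> 0) (at 0)"
      by (simp add: h_norm)
    then show ?thesis
      using True by (simp add: isCont_def tendsto_norm_zero_iff h_def[of 0])
  next
    case False
    then show ?thesis
      unfolding h_def by (intro continuous_intros) auto
  qed
  then have "continuous_on UNIV (\<lambda>x. h (F x))"
    by (intro continuous_on_compose2[of UNIV h UNIV F])
      (auto intro: continuous_at_imp_continuous_on)
  then have G: "Bcontfun (\<lambda>x. h (F x)) x = h (F x)" for x
    by (simp add: Bcontfun_inverse continuous_imp_bcontfun)
  show g: "continuous_on UNIV (\<lambda>x. sqrt (norm (F x)))"
    by (intro continuous_intros) simp
  show "F = scalar_fun (\<lambda>x. sqrt (norm (F x))) * Bcontfun (\<lambda>x. h (F x))"
  proof (rule bcontfun_eqI)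
    fix x
    show "F x = (scalar_fun (\<lambda>x. sqrt (norm (F x))) * Bcontfun (\<lambda>x. h (F x))) x"
      by (cases "F x = 0") (simp_all add: g G, simp add: h_def)
  qed
qed simp

end


section \<open>Pure states\<close>

text \<open>The element \<open>e\<close> plays the part of the unit: if
  \<open>\<rho> (w * a) = t * \<rho> a\<close> for all \<open>a\<close>, then
  \<open>\<rho> (w * e)\<close> is the scalar \<open>t\<close>.\<close>

lemma pure_state_nonzero:
  assumes "\<rho> \<in> pure_states"
  obtains e where "\<rho> e = 1"
proof -
  have lin: "clinear \<rho>" and norm: "onorm \<rho> = 1"
    using assms by (simp_all add: pure_states_def state_def positive_functional_def)
  have "\<exists>a. \<rho> a \<noteq> 0"
  proof (rule ccontr)
    assume "\<nexists>a. \<rho> a \<noteq> 0"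
    then have "\<rho> = (\<lambda>_. 0)"
      by auto
    then show False
      using norm by (simp add: onorm_zero)
  qed
  then obtain a where "\<rho> a \<noteq> 0"
    by blast
  then have "\<rho> (inverse (\<rho> a) *\<^sub>C a) = 1"
    using lin by (simp add: clinear_iff)
  then show ?thesis
    by (rule that)
qed

text \<open>The squared norm of \<open>\<pi> c (\<pi> a \<xi>)\<close> is
  \<open>\<rho> ((c * a)\<^sup>\<star> * c * a) = 0\<close>. So \<open>\<pi> c\<close> vanishes on
  the dense orbit of \<open>\<xi>\<close> and, being bounded, on \<open>H\<close>.\<close>

lemma gns_annihilates:
  assumes "gns_representation \<rho> H \<pi> \<xi>" and "\<And>a b. \<rho> (a * c * b) = 0" and "u \<in> H"
  shows "\<pi> c u = 0"
proof -
  have rep: "representation H \<pi>" and xi: "\<xi> \<in> H"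
    and dense: "closure (range (\<lambda>a. \<pi> a \<xi>)) = H" and rho: "\<And>a. \<rho> a = cinner (\<pi> a \<xi>) \<xi>"
    using assms(1) by (auto simp: gns_representation_def)
  have bop: "\<And>c. bounded_operator_on H (\<pi> c)"
    and mult: "\<And>a b u. u \<in> H \<Longrightarrow> \<pi> (a * b) u = \<pi> a (\<pi> b u)"
    and adj: "\<And>a u v. u \<in> H \<Longrightarrow> v \<in> H \<Longrightarrow> cinner (\<pi> (a\<^sup>\<star>) u) v = cinner u (\<pi> a v)"
    and sub: "complex_vector.subspace H"
    using rep by (auto simp: representation_def)
  have H: "\<pi> a v \<in> H" if "v \<in> H" for a v
    using bop[of a] that by (auto simp: bounded_operator_on_def)
  have cyclic: "\<pi> c (\<pi> a \<xi>) = 0" for a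
  proof -
    define v where "v = \<pi> c (\<pi> a \<xi>)"
    have v: "v = \<pi> (c * a) \<xi>" "v \<in> H"
      by (simp_all add: v_def mult xi H)
    have "cinner v v = cinner (\<pi> ((c * a)\<^sup>\<star>) v) \<xi>"
      using adj[OF v(2) xi, of "c * a"] v(1) by simp
    also have "\<dots> = \<rho> ((c * a)\<^sup>\<star> * c * a)"
      using v xi by (simp add: rho mult mult.assoc)
    finally have "cinner v v = 0"
      by (simp add: assms(2))
    then show ?thesis
      by (simp add: cinner_self v_def)
  qed
  have "\<exists>K. \<forall>v\<in>H. norm (\<pi> c v) \<le> K * norm v"
    using bop[of c] unfolding bounded_operator_on_def by (elim conjE)
  then obtain K where K: "\<forall>v\<in>H. norm (\<pi> c v) \<le> K * norm v" ..
  have "u \<in> closure (range (\<lambda>a. \<pi> a \<xi>))"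
    using assms(3) dense by simp
  then obtain s where s: "\<And>n. s n \<in> range (\<lambda>a. \<pi> a \<xi>)" "s \<longlonglongrightarrow> u"
    by (auto simp: closure_sequential)
  \<comment> \<open>Additivity and boundedness hold only on \<open>H\<close>, so \<open>u\<close> is
    split inside \<open>H\<close>, with the summand \<open>s n\<close> annihilated.\<close>
  have bound: "norm (\<pi> c u) \<le> K * norm (u - s n)" for n
  proof -
    have sn: "s n \<in> H" "\<pi> c (s n) = 0"
      using s(1)[of n] cyclic xi H by auto
    have diff: "u - s n \<in> H"
      by (intro complex_vector.subspace_diff sub assms(3) sn)
    have "\<pi> c ((u - s n) + s n) = \<pi> c (u - s n) + \<pi> c (s n)"
      using bop[of c] diff sn(1) unfolding bounded_operator_on_def by blast
    then show ?thesis
      using K diff sn(2) by fastforce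
  qed
  have "(\<lambda>n. K * norm (u - s n)) \<longlonglongrightarrow> K * norm (u - u)"
    by (intro tendsto_intros s(2))
  then have "norm (\<pi> c u) \<le> K * norm (u - u)"
    using bound by (intro LIMSEQ_le_const) auto
  then show ?thesis
    by simp
qed

section \<open>Evaluation of Jordan homomorphisms at a point\<close>

lemma jordan_star_hom_at_point:
  fixes J :: "('x::topological_space \<Rightarrow>\<^sub>C 'a::unital_cstar_algebra)
    \<Rightarrow> ('y::topological_space \<Rightarrow>\<^sub>C 'b::unital_cstar_algebra)"
  assumes "jordan_star_hom J"
  shows "jordan_star_hom (\<lambda>a. J (const_bcontfun a) y)"
proof -
  have c: "const_bcontfun (a + b) = (const_bcontfun a + const_bcontfun b :: 'x \<Rightarrow>\<^sub>C 'a)"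
    "const_bcontfun (jordan_prod a b) = (jordan_prod (const_bcontfun a) (const_bcontfun b) :: 'x \<Rightarrow>\<^sub>C 'a)"
    "const_bcontfun (k *\<^sub>C a) = (k *\<^sub>C const_bcontfun a :: 'x \<Rightarrow>\<^sub>C 'a)"
    "const_bcontfun (a\<^sup>\<star>) = ((const_bcontfun a)\<^sup>\<star> :: 'x \<Rightarrow>\<^sub>C 'a)" for a b :: 'a and k
    by (rule bcontfun_eqI; simp add: jordan_prod_def)+
  have "jordan_prod F G y = jordan_prod (F y) (G y)" for F G :: "'y \<Rightarrow>\<^sub>C 'b"
    by (simp add: jordan_prod_def)
  then show ?thesis
    using assms unfolding jordan_star_hom_def clinear_iff c by simp
qed

context
  fixes J :: "('x::t2_space \<Rightarrow>\<^sub>C 'a::unital_cstar_algebra) \<Rightarrow> ('y::t2_space \<Rightarrow>\<^sub>C 'b::unital_cstar_algebra)"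
  assumes compact: "compact (UNIV :: 'x set)"
    and iso: "jordan_star_iso J"
begin

lemmas jordan_iso_linear = jordan_star_homD(1)[OF jordan_iso_hom[OF iso]]

text \<open>Every element of the target algebra is the value at \<open>y\<close> of a constant map,
  so centrality passes to the value at \<open>y\<close>.\<close>

lemma scalar_image_central:
  assumes "continuous_on UNIV f"
  shows "J (scalar_fun f) y * a = a * J (scalar_fun f) y"
proof -
  have "J (scalar_fun f) * const_bcontfun a = const_bcontfun a * J (scalar_fun f)"
    using jordan_iso_central[OF iso scalar_fun_central[OF compact assms]] by (simp add: central_def)
  then have "(J (scalar_fun f) * const_bcontfun a) y = (const_bcontfun a * J (scalar_fun f)) y"
    by simp
  then show ?thesis
    by simp
qed

lemma scalar_image_mult:
  assumes "continuous_on UNIV f"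
  shows "J (scalar_fun f * G) y = J (scalar_fun f) y * J G y"
  by (simp add: jordan_iso_mult_central[OF iso scalar_fun_central[OF compact assms]])

lemma scalar_image_add:
  assumes "continuous_on UNIV f" "continuous_on UNIV g"
  shows "J (scalar_fun (\<lambda>x. f x + g x)) y = J (scalar_fun f) y + J (scalar_fun g) y"
  using jordan_iso_linear by (simp add: scalar_fun_add[OF compact assms] clinear_iff)

lemma scalar_image_const: "J (scalar_fun (\<lambda>_. c)) y = c *\<^sub>R 1"
  by (simp add: scalar_fun_const[OF compact] clinear_scaleR[OF jordan_iso_linear] jordan_iso_one[OF iso])

text \<open>The square root of \<open>f\<close> yields a self-adjoint central \<open>w\<close> whose
  square is the image of \<open>f\<close> at \<open>y\<close>, so \<open>w * w * (a\<^sup>\<star> *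
  a) = (w * a)\<^sup>\<star> * (w * a)\<close>.\<close>

lemma positive_functional_scalar_image:
  assumes "positive_functional \<rho>" and "continuous_on UNIV f" and "\<And>x. f x \<ge> 0"
  shows "positive_functional (\<lambda>a. \<rho> (J (scalar_fun f) y * a))"
  unfolding positive_functional_def
proof (intro conjI allI)
  have "clinear \<rho>"
    using assms(1) by (simp add: positive_functional_def)
  then show "clinear (\<lambda>a. \<rho> (J (scalar_fun f) y * a))"
    by (simp add: clinear_iff distrib_left mult_scaleC_right)
  fix a
  define s where "s = (\<lambda>x. sqrt (f x))"
  have s: "continuous_on UNIV s"
    unfolding s_def by (intro continuous_on_real_sqrt assms(2))
  define w where "w = J (scalar_fun s) y"
  have "f = (\<lambda>x. s x * s x)"
    using assms(3) by (simp add: s_def)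
  then have w_sq: "J (scalar_fun f) y = w * w"
    by (simp add: w_def scalar_fun_mult[OF compact s s] scalar_image_mult[OF s])
  have w_star: "w\<^sup>\<star> = w"
    using jordan_star_homD(2)[OF jordan_iso_hom[OF iso], of "scalar_fun s"]
    by (metis w_def scalar_fun_star[OF compact s] star_bcontfun.rep_eq)
  have w_comm: "b * w = w * b" for b
    by (simp add: w_def scalar_image_central[OF s])
  have "J (scalar_fun f) y * (a\<^sup>\<star> * a) = (w * a)\<^sup>\<star> * (w * a)"
    by (simp add: w_sq star_mult w_star) (metis mult.assoc w_comm)
  then show "\<rho> (J (scalar_fun f) y * (a\<^sup>\<star> * a)) \<in> \<real>\<^sub>\<ge>\<^sub>0"
    using assms(1) by (simp add: positive_functional_def)
qed

text \<open>Purity settles functions with values in [0,1], where both \<open>g\<close> and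
  \<open>1 - g\<close> give positive functionals; an affine change of scale does the rest.\<close>

lemma pure_state_scalar_image:
  assumes "\<rho> \<in> pure_states" and f: "continuous_on UNIV f"
  shows "\<exists>t::real. \<forall>a. \<rho> (J (scalar_fun f) y * a) = of_real t * \<rho> a"
proof -
  have pos: "positive_functional \<rho>" and rho_lin: "clinear \<rho>"
    using assms(1) by (simp_all add: pure_states_def state_def positive_functional_def)
  have unit: "\<exists>t::real. \<forall>a. \<rho> (J (scalar_fun g) y * a) = of_real t * \<rho> a"
    if g: "continuous_on UNIV g" and bounds: "\<And>x. 0 \<le> g x" "\<And>x. g x \<le> 1" for g
  proof -
    have cont': "continuous_on UNIV (\<lambda>x. 1 + -1 * g x)"
      by (intro continuous_intros g)
    have "J (scalar_fun (\<lambda>x. 1 + -1 * g x)) y = 1 - J (scalar_fun g) y"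
    proof -
      have "J (scalar_fun (\<lambda>x. -1 * g x)) y = - J (scalar_fun g) y"
        by (subst scalar_fun_mult[OF compact]) (simp_all only: g continuous_on_const
            scalar_image_mult[OF continuous_on_const] scalar_image_const, simp)
      moreover have "continuous_on UNIV (\<lambda>x. -1 * g x)"
        by (intro continuous_intros g)
      ultimately show ?thesis
        using scalar_image_add[of "\<lambda>_. 1" "\<lambda>x. -1 * g x" y] scalar_image_const[of 1 y] by simp
    qed
    then have "\<rho> a - \<rho> (J (scalar_fun g) y * a) = \<rho> (J (scalar_fun (\<lambda>x. 1 + -1 * g x)) y * a)" for a
      by (simp only: left_diff_distrib clinear_diff[OF rho_lin] mult_1)
    then have "positive_functional (\<lambda>a. \<rho> a - \<rho> (J (scalar_fun g) y * a))"
      using positive_functional_scalar_image[OF pos cont', of y] bounds(2) by simp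
    then show ?thesis
      using assms(1) positive_functional_scalar_image[OF pos g bounds(1), of y]
      unfolding pure_states_def by blast
  qed
  obtain M where M: "M > 0" "\<And>x. \<bar>f x\<bar> \<le> M"
  proof -
    have "bounded (range f)"
      using continuous_imp_bcontfun[OF compact f] by (simp add: bcontfun_def)
    then show ?thesis
      using that by (auto simp: bounded_pos)
  qed
  \<comment> \<open>This maps the interval from \<open>-M\<close> to \<open>M\<close> onto [0,1];
    \<open>M > 0\<close> permits the division.\<close>
  define g where "g = (\<lambda>x. (f x + M) * (1 / (2 * M)))"
  have g: "continuous_on UNIV g"
    unfolding g_def by (intro continuous_intros f)
  have "0 \<le> g x" "g x \<le> 1" for x
    using M(1) M(2)[of x] by (auto simp: g_def field_simps abs_le_iff)
  then obtain t where t: "\<And>a. \<rho> (J (scalar_fun g) y * a) = complex_of_real t * \<rho> a"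
    using unit[OF g] by blast
  have f_eq: "f = (\<lambda>x. (2 * M) * g x + - M)"
    using M(1) by (simp add: g_def fun_eq_iff)
  have "continuous_on UNIV (\<lambda>x. (2 * M) * g x)"
    by (intro continuous_intros g)
  then have "J (scalar_fun f) y = J (scalar_fun (\<lambda>x. (2 * M) * g x)) y + (- M) *\<^sub>R 1"
    unfolding f_eq by (simp only: scalar_image_add continuous_on_const scalar_image_const)
  also have "J (scalar_fun (\<lambda>x. (2 * M) * g x)) y = (2 * M) *\<^sub>R J (scalar_fun g) y"
    by (subst scalar_fun_mult[OF compact]) (simp_all only: g continuous_on_const
        scalar_image_mult[OF continuous_on_const] scalar_image_const, simp)
  finally have "J (scalar_fun f) y = (2 * M) *\<^sub>R J (scalar_fun g) y + (- M) *\<^sub>R 1" .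
  then have "J (scalar_fun f) y * a = (2 * M) *\<^sub>R (J (scalar_fun g) y * a) - M *\<^sub>R a" for a
    by (simp only: distrib_right left_diff_distrib mult_scaleR_left mult_1 scaleR_minus_left
        add_uminus_conv_diff)
  then have "\<rho> (J (scalar_fun f) y * a) = (2 * M) *\<^sub>R (of_real t * \<rho> a) - M *\<^sub>R \<rho> a" for a
    by (simp only: clinear_diff[OF rho_lin] clinear_scaleR[OF rho_lin] t)
  then have "\<rho> (J (scalar_fun f) y * a) = of_real (2 * M * t - M) * \<rho> a" for a
    by (simp add: scaleR_conv_of_real algebra_simps)
  then show ?thesis
    by blast
qed

text \<open>The scalars from \<open>pure_state_scalar_image\<close> form a character: extracting the
  factors of a product one after the other multiplies their scalars.\<close>

lemma pure_state_point:
  assumes "\<rho> \<in> pure_states"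
  shows "\<exists>x. \<forall>f. continuous_on UNIV f \<longrightarrow> (\<forall>a. \<rho> (J (scalar_fun f) y * a) = of_real (f x) * \<rho> a)"
proof -
  obtain e where e: "\<rho> e = 1"
    using pure_state_nonzero[OF assms] .
  have rho_lin: "clinear \<rho>"
    using assms by (simp add: pure_states_def state_def positive_functional_def)
  \<comment> \<open>For continuous \<open>f\<close> the scalar is real and
    \<open>\<rho> e = 1\<close>, so taking the real part loses nothing.\<close>
  define \<eta> where "\<eta> f = Re (\<rho> (J (scalar_fun f) y * e))" for f
  have chi: "\<rho> (J (scalar_fun f) y * a) = of_real (\<eta> f) * \<rho> a" if f: "continuous_on UNIV f" for f a
    using pure_state_scalar_image[OF assms f, of y] e by (auto simp: \<eta>_def)
  have "\<eta> (\<lambda>x. f x + g x) = \<eta> f + \<eta> g" if "continuous_on UNIV f" "continuous_on UNIV g" for f g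
    using rho_lin by (simp add: \<eta>_def scalar_image_add[OF that] distrib_right clinear_iff)
  moreover have "\<eta> (\<lambda>x. f x * g x) = \<eta> f * \<eta> g"
    if f: "continuous_on UNIV f" and g: "continuous_on UNIV g" for f g
  proof -
    have "\<rho> (J (scalar_fun (\<lambda>x. f x * g x)) y * e) = of_real (\<eta> f * \<eta> g)"
      by (simp add: scalar_fun_mult[OF compact f g] scalar_image_mult[OF f] chi f g mult.assoc e)
    then show ?thesis
      by (simp add: \<eta>_def[of "\<lambda>x. f x * g x"])
  qed
  moreover have "\<eta> (\<lambda>_. c) = c" for c
    by (simp add: \<eta>_def scalar_image_const clinear_scaleR[OF rho_lin] e)
  ultimately have "\<exists>x. \<forall>f. continuous_on UNIV f \<longrightarrow> \<eta> f = f x"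
    by (intro character_is_evaluation compact)
  then show ?thesis
    using chi by metis
qed

text \<open>Write \<open>F = scalar_fun g * G\<close> with \<open>g x = 0\<close>. The central image
  of \<open>g\<close> moves to the front of \<open>a * J F y * b\<close>, where
  \<open>\<rho>\<close> turns it into the factor \<open>g x\<close>.\<close>

lemma gns_vanishing:
  fixes F :: "'x \<Rightarrow>\<^sub>C 'a"
  assumes "gns_representation \<rho> H \<pi> \<xi>" and "u \<in> H" and "F x = 0"
    and point: "\<And>f a. continuous_on UNIV f \<Longrightarrow> \<rho> (J (scalar_fun f) y * a) = of_real (f x) * \<rho> a"
  shows "\<pi> (J F y) u = 0"
proof (rule gns_annihilates[OF assms(1) _ assms(2)])
  obtain g G where g: "continuous_on UNIV g" and F: "F = scalar_fun g * G"
    and "\<And>x. F x = 0 \<Longrightarrow> g x = 0"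
    using scalar_fun_factorization[OF compact, of F] by blast
  then have "g x = 0"
    using assms(3) by blast
  fix a b
  have "a * J F y * b = J (scalar_fun g) y * (a * J G y * b)"
    by (simp add: F scalar_image_mult[OF g] flip: mult.assoc scalar_image_central[OF g])
  then show "\<rho> (a * J F y * b) = 0"
    using \<open>g x = 0\<close> by (simp add: point[OF g])
qed

end

theorem theorem2p5:
  fixes J :: "('x::t2_space \<Rightarrow>\<^sub>C 'a::unital_cstar_algebra) \<Rightarrow> ('y::t2_space \<Rightarrow>\<^sub>C 'b::unital_cstar_algebra)"
  assumes "compact (UNIV :: 'x set)" and "compact (UNIV :: 'y set)"
    and "jordan_star_iso J"
  shows "\<exists>(\<phi> :: ('b \<Rightarrow> complex) \<Rightarrow> 'y \<Rightarrow> 'x) (V :: 'y \<Rightarrow> 'a \<Rightarrow> 'b).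
    (\<forall>\<rho>\<in>pure_states. continuous_on UNIV (\<phi> \<rho>))
    \<and> (\<forall>y. jordan_star_hom (V y))
    \<and> (\<forall>\<rho>\<in>pure_states. \<forall>(H :: 'h::complex_hilbert_space set) \<pi> \<xi>.
        gns_representation \<rho> H \<pi> \<xi> \<longrightarrow>
        (\<forall>F y. \<forall>u\<in>H. \<pi> (J F y) u = \<pi> (V y (F (\<phi> \<rho> y))) u))"
proof -
  note compact = assms(1) and iso = assms(3)
  define \<phi> where "\<phi> \<rho> y = (SOME x. \<forall>f. continuous_on UNIV f
      \<longrightarrow> (\<forall>a. \<rho> (J (scalar_fun f) y * a) = of_real (f x) * \<rho> a))" for \<rho> :: "'b \<Rightarrow> complex" and y
  have \<phi>: "\<rho> (J (scalar_fun f) y * a) = of_real (f (\<phi> \<rho> y)) * \<rho> a"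
    if "\<rho> \<in> pure_states" "continuous_on UNIV f" for \<rho> y f a
    using someI_ex[OF pure_state_point[OF compact iso that(1), of y]] that(2)
    unfolding \<phi>_def by blast
  define V where "V y a = J (const_bcontfun a) y" for y a
  have "continuous_on UNIV (\<phi> \<rho>)" if \<rho>: "\<rho> \<in> pure_states" for \<rho>
  proof (rule continuous_into_compact_Hausdorff[OF compact])
    fix f :: "'x \<Rightarrow> real"
    assume f: "continuous_on UNIV f"
    obtain e where e: "\<rho> e = 1"
      using pure_state_nonzero[OF \<rho>] .
    have "bounded_linear \<rho>"
      using \<rho> by (simp add: pure_states_def state_def)
    \<comment> \<open>By the choice of \<open>\<phi> \<rho> y\<close> and
      \<open>\<rho> e = 1\<close>, this function of \<open>y\<close> is
      \<open>f (\<phi> \<rho> y)\<close>.\<close>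
    then have "continuous_on UNIV (\<lambda>y. Re (\<rho> (J (scalar_fun f) y * e)))"
      by (intro continuous_on_Re bounded_linear.continuous_on[of \<rho>] continuous_on_mult
          continuous_on_apply_bcontfun continuous_on_const)
    then show "continuous_on UNIV (\<lambda>y. f (\<phi> \<rho> y))"
      by (simp add: \<phi>[OF \<rho> f] e)
  qed
  moreover have "jordan_star_hom (V y)" for y
    unfolding V_def by (rule jordan_star_hom_at_point[OF jordan_iso_hom[OF iso]])
  moreover have "\<pi> (J F y) u = \<pi> (V y (F (\<phi> \<rho> y))) u"
    if \<rho>: "\<rho> \<in> pure_states" and gns: "gns_representation \<rho> H \<pi> \<xi>" and u: "u \<in> H"
    for \<rho> and H :: "'h set" and \<pi> \<xi> F y u
  proof -
    \<comment> \<open>Subtracting this constant map makes \<open>F\<close> vanish at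
      \<open>\<phi> \<rho> y\<close>, and \<open>J ?C y\<close> is the value of \<open>V y\<close>
      sought.\<close>
    let ?C = "const_bcontfun (F (\<phi> \<rho> y))"
    have "\<pi> (J F y) u = \<pi> (J (F - ?C) y + J ?C y) u"
      by (simp add: clinear_diff[OF jordan_iso_linear[OF compact iso]])
    also have "\<dots> = \<pi> (J (F - ?C) y) u + \<pi> (J ?C y) u"
      using gns u by (simp add: gns_representation_def representation_def)
    also have "\<pi> (J (F - ?C) y) u = 0"
      by (rule gns_vanishing[OF compact iso gns u _ \<phi>[OF \<rho>]]) simp_all
    finally show ?thesis
      by (simp add: V_def)
  qed
  ultimately show ?thesis
    by blast
qed

end
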